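(* Let $K$ be a closed Zariski dense subset of $\mathbb{R}^n$ and let $d\ge1$ be an integer. (1) The family of multiplicative seminorms $\mathcal{F}_K=\{\rho_x:x\in K\}$, $\rho_x(f)=|f(x)|$, induces a locally multiplicatively convex Hausdorff topology $\mathcal{T}_K$ on $\mathbb{R}[\underline X]=\mathbb{R}[X_1,\dots,X_n]$ such that $\overline{\sum\mathbb{R}[\underline X]^{2d}}^{\,\mathcal{T}_K}=\mathrm{Psd}(K)$. (2) If $K$ is compact, then $\|f\|_K=\sup_{x\in K}|f(x)|$ induces a norm on $\mathbb{R}[\underline X]$ such that $\overline{\sum\mathbb{R}[\underline X]^{2d}}^{\,\|\cdot\|_K}=\mathrm{Psd}(K)$.
   Context: "Closed" and "compact" refer to the Euclidean topology of $\mathbb{R}^n$; Zariski dense means dense in the Zariski topology of $\mathbb{R}^n$ (closed sets are common zero sets in $\mathbb{R}^n$ of sets of real polynomials). A locally convex topology on an $\mathbb{R}$-algebra is locally multiplicatively convex if $0$ has a fundamental system of neighborhoods $U$ with $U\cdot U\subseteq U$; a seminorm $\rho$ is multiplicative if $\rho(xy)\le\rho(x)\rho(y)$. The topology generated by a family of seminorms is the locally convex topology whose basic neighborhoods of $f$ are $\{g:\rho_i(f-g)\le\epsilon,\ i=1,\dots,k\}$ with $\epsilon>0$ and $\rho_1,\dots,\rho_k$ in the family. $\sum\mathbb{R}[\underline X]^{2d}$ is the set of finite sums of $2d$-th powers of polynomials. $\mathrm{Psd}(K):=\{f\in\mathbb{R}[\underline X]:f(x)\ge0\text{ for all }x\in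 K\}$. Overlines denote closures in the indicated topologies. *)

theory Defs
  imports "HOL-Analysis.Analysis" "HOL-Library.Poly_Mapping"
begin

section \<open>Real polynomials in finitely many variables\<close>

text \<open>
  The type \<open>('n \<Rightarrow>\<^sub>0 nat) \<Rightarrow>\<^sub>0 real\<close> with its convolution product is the polynomial ring over the
  reals in variables indexed by \<open>'n\<close>; the inner level holds the exponent vectors. The library
  makes it a commutative ring; the scalar multiplication is supplied here.
\<close>

type_synonym 'n rpoly = "('n \<Rightarrow>\<^sub>0 nat) \<Rightarrow>\<^sub>0 real"

instantiation poly_mapping :: (type, real_vector) real_vector
begin

lift_definition scaleR_poly_mapping :: "real \<Rightarrow> ('a \<Rightarrow>\<^sub>0 'b) \<Rightarrow> 'a \<Rightarrow>\<^sub>0 'b"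
  is "\<lambda>c f k. c *\<^sub>R f k"
  by (rule finite_subset) auto

instance
  by standard (transfer; simp add: algebra_simps)+

end

lemma lookup_scaleR [simp]: "Poly_Mapping.lookup (c *\<^sub>R p) k = c *\<^sub>R Poly_Mapping.lookup p k"
  by transfer simp

lemma scaleR_poly_mapping_conv_mult:
  fixes p :: "'a::comm_monoid_add \<Rightarrow>\<^sub>0 'b::{comm_ring_1,real_algebra_1}"
  shows "c *\<^sub>R p = Poly_Mapping.single 0 (of_real c) * p"
proof -
  have "c *\<^sub>R p = Poly_Mapping.map ((*) (of_real c)) p"
    by transfer (auto simp: fun_eq_iff when_def scaleR_conv_of_real)
  then show ?thesis by (simp add: mult_map_scale_conv_mult)
qed

instance poly_mapping :: (comm_monoid_add, "{comm_ring_1,real_algebra_1}") real_algebra_1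
  by standard (simp_all add: scaleR_poly_mapping_conv_mult ac_simps)

definition eval_monom :: "('n::finite \<Rightarrow>\<^sub>0 nat) \<Rightarrow> real ^ 'n \<Rightarrow> real" where
  "eval_monom m x = (\<Prod>i\<in>UNIV. (x $ i) ^ Poly_Mapping.lookup m i)"

definition eval_poly :: "'n::finite rpoly \<Rightarrow> real ^ 'n \<Rightarrow> real" where
  "eval_poly p x = (\<Sum>m\<in>Poly_Mapping.keys p. Poly_Mapping.lookup p m * eval_monom m x)"

lemma eval_monom_add: "eval_monom (m + k) x = eval_monom m x * eval_monom k x"
  by (simp add: eval_monom_def lookup_add power_add prod.distrib)

lemma eval_monom_0 [simp]: "eval_monom 0 x = 1"
  by (simp add: eval_monom_def)

lemma eval_poly_superset:
  assumes "finite A" "Poly_Mapping.keys p \<subseteq> A"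
  shows "eval_poly p x = (\<Sum>m\<in>A. Poly_Mapping.lookup p m * eval_monom m x)"
  unfolding eval_poly_def
  by (rule sum.mono_neutral_left) (use assms in \<open>auto simp: in_keys_iff\<close>)

lemma eval_poly_0 [simp]: "eval_poly 0 x = 0"
  by (simp add: eval_poly_def)

lemma eval_poly_single: "eval_poly (Poly_Mapping.single m a) x = a * eval_monom m x"
  by (subst eval_poly_superset[of "{m}"]) (auto simp: lookup_single)

lemma eval_poly_1 [simp]: "eval_poly 1 x = 1"
  using eval_poly_single[of 0 1 x] by simp

lemma eval_poly_add: "eval_poly (p + q) x = eval_poly p x + eval_poly q x"
proof -
  have "Poly_Mapping.keys (p + q) \<subseteq> Poly_Mapping.keys p \<union> Poly_Mapping.keys q" by (rule keys_add)
  then show ?thesis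
    by (simp add: eval_poly_superset[of "Poly_Mapping.keys p \<union> Poly_Mapping.keys q"] lookup_add distrib_right sum.distrib)
qed

lemma eval_poly_scaleR: "eval_poly (c *\<^sub>R p) x = c * eval_poly p x"
proof -
  have "Poly_Mapping.keys (c *\<^sub>R p) \<subseteq> Poly_Mapping.keys p" by (auto simp: in_keys_iff)
  then show ?thesis
    by (simp add: eval_poly_superset[of "Poly_Mapping.keys p"] sum_distrib_left mult.assoc)
qed

lemma eval_poly_sum: "eval_poly (sum f A) x = (\<Sum>a\<in>A. eval_poly (f a) x)"
  by (induction A rule: infinite_finite_induct) (simp_all add: eval_poly_add)

lemma rpoly_sum_monomials:
  "p = (\<Sum>m\<in>Poly_Mapping.keys p. Poly_Mapping.single m (Poly_Mapping.lookup p m))"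
proof (rule poly_mapping_eqI)
  fix k
  show "Poly_Mapping.lookup p k = Poly_Mapping.lookup (\<Sum>m\<in>Poly_Mapping.keys p. Poly_Mapping.single m (Poly_Mapping.lookup p m)) k"
    by (auto simp: lookup_sum lookup_single when_def in_keys_iff)
qed

lemma eval_poly_mult: "eval_poly (p * q) x = eval_poly p x * eval_poly q x"
proof -
  have "p * q = (\<Sum>m\<in>Poly_Mapping.keys p. \<Sum>k\<in>Poly_Mapping.keys q.
      Poly_Mapping.single (m + k) (Poly_Mapping.lookup p m * Poly_Mapping.lookup q k))"
    using arg_cong2[OF rpoly_sum_monomials[of p] rpoly_sum_monomials[of q], of "(*)"]
    unfolding sum_product mult_single .
  then have "eval_poly (p * q) x =
      (\<Sum>m\<in>Poly_Mapping.keys p. \<Sum>k\<in>Poly_Mapping.keys q. Poly_Mapping.lookup p m * Poly_Mapping.lookup q k * eval_monom (m + k) x)"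
    by (simp add: eval_poly_sum eval_poly_single)
  also have "\<dots> = eval_poly p x * eval_poly q x"
    unfolding eval_poly_def sum_product by (simp add: eval_monom_add ac_simps)
  finally show ?thesis .
qed

section \<open>The Zariski topology\<close>

definition zero_locus :: "'n::finite rpoly set \<Rightarrow> (real ^ 'n) set" where
  "zero_locus P = {x. \<forall>p\<in>P. eval_poly p x = 0}"

definition zariski_topology :: "(real ^ 'n::finite) topology" where
  "zariski_topology = topology (\<lambda>U. \<exists>P. - U = zero_locus P)"

lemma zero_locus_Un:
  "zero_locus P \<union> zero_locus Q = zero_locus {p * q | p q. p \<in> P \<and> q \<in> Q}"
proof (intro set_eqI iffI)
  fix x assume x: "x \<in> zero_locus {p * q | p q. p \<in> P \<and> q \<in> Q}"
  have "eval_poly p x * eval_poly q x = 0" if "p \<in> P" "q \<in> Q" for p q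
    using x that unfolding zero_locus_def eval_poly_mult[symmetric] by blast
  then show "x \<in> zero_locus P \<union> zero_locus Q"
    unfolding zero_locus_def mult_eq_0_iff by blast
next
  fix x assume x: "x \<in> zero_locus P \<union> zero_locus Q"
  have "eval_poly (p * q) x = 0" if "p \<in> P" "q \<in> Q" for p q
    using x that by (auto simp: zero_locus_def eval_poly_mult)
  then show "x \<in> zero_locus {p * q | p q. p \<in> P \<and> q \<in> Q}"
    unfolding zero_locus_def by blast
qed

lemma istopology_zariski: "istopology (\<lambda>U. \<exists>P. - U = zero_locus P)"
  unfolding istopology_def
proof (intro conjI allI impI)
  fix S T :: "(real ^ 'n) set"
  assume "\<exists>P. - S = zero_locus P" "\<exists>P. - T = zero_locus P"
  then obtain P Q where "- S = zero_locus P" "- T = zero_locus Q" by blast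
  then have "- (S \<inter> T) = zero_locus {p * q | p q. p \<in> P \<and> q \<in> Q}"
    by (simp only: Compl_Int zero_locus_Un)
  then show "\<exists>P. - (S \<inter> T) = zero_locus P" by (rule exI)
next
  fix \<U> :: "(real ^ 'n) set set"
  assume "\<forall>U\<in>\<U>. \<exists>P. - U = zero_locus P"
  then have "\<exists>P. \<forall>U\<in>\<U>. - U = zero_locus (P U)" by (rule bchoice)
  then obtain P where P: "\<forall>U\<in>\<U>. - U = zero_locus (P U)" ..
  have "- \<Union>\<U> = (\<Inter>U\<in>\<U>. - U)" by blast
  also have "\<dots> = (\<Inter>U\<in>\<U>. zero_locus (P U))" using P by (intro INF_cong) simp_all
  also have "\<dots> = zero_locus (\<Union>U\<in>\<U>. P U)" unfolding zero_locus_def by blast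
  finally show "\<exists>P. - \<Union>\<U> = zero_locus P" by (rule exI)
qed

lemma openin_zariski_topology: "openin zariski_topology U \<longleftrightarrow> (\<exists>P. - U = zero_locus P)"
  unfolding zariski_topology_def by (simp add: topology_inverse'[OF istopology_zariski])

lemma topspace_zariski_topology [simp]:
  "topspace (zariski_topology :: (real ^ 'n::finite) topology) = UNIV"
proof -
  have "- UNIV = zero_locus {1 :: 'n rpoly}" by (simp add: zero_locus_def)
  then have "openin zariski_topology (UNIV :: (real ^ 'n) set)"
    by (auto simp only: openin_zariski_topology)
  then show ?thesis using openin_subset by auto
qed

lemma closedin_zariski_topology: "closedin zariski_topology S \<longleftrightarrow> (\<exists>P. S = zero_locus P)"
  by (simp add: closedin_def openin_zariski_topology Compl_eq_Diff_UNIV[symmetric])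

definition zariski_dense :: "(real ^ 'n::finite) set \<Rightarrow> bool" where
  "zariski_dense S \<longleftrightarrow> zariski_topology closure_of S = UNIV"

section \<open>Seminorms and locally convex topologies\<close>

definition seminorm :: "('a::real_vector \<Rightarrow> real) \<Rightarrow> bool" where
  "seminorm \<rho> \<longleftrightarrow> (\<forall>x. 0 \<le> \<rho> x) \<and> (\<forall>x y. \<rho> (x + y) \<le> \<rho> x + \<rho> y) \<and> (\<forall>c x. \<rho> (c *\<^sub>R x) = \<bar>c\<bar> * \<rho> x)"

definition multiplicative_seminorm :: "('a::real_algebra \<Rightarrow> real) \<Rightarrow> bool" where
  "multiplicative_seminorm \<rho> \<longleftrightarrow> seminorm \<rho> \<and> (\<forall>x y. \<rho> (x * y) \<le> \<rho> x * \<rho> y)"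

definition is_norm :: "('a::real_vector \<Rightarrow> real) \<Rightarrow> bool" where
  "is_norm \<rho> \<longleftrightarrow> seminorm \<rho> \<and> (\<forall>x. \<rho> x = 0 \<longrightarrow> x = 0)"

definition basic_nbhd :: "('a::real_vector \<Rightarrow> real) set \<Rightarrow> real \<Rightarrow> 'a \<Rightarrow> 'a set" where
  "basic_nbhd R \<epsilon> f = {g. \<forall>\<rho>\<in>R. \<rho> (f - g) \<le> \<epsilon>}"

definition seminorm_topology :: "('a::real_vector \<Rightarrow> real) set \<Rightarrow> 'a topology" where
  "seminorm_topology F = topology (\<lambda>U. \<forall>f\<in>U. \<exists>R \<epsilon>.
     finite R \<and> R \<subseteq> F \<and> \<epsilon> > 0 \<and> basic_nbhd R \<epsilon> f \<subseteq> U)"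

lemma basic_nbhd_mono: "R \<subseteq> R' \<Longrightarrow> \<epsilon>' \<le> \<epsilon> \<Longrightarrow> basic_nbhd R' \<epsilon>' f \<subseteq> basic_nbhd R \<epsilon> f"
  unfolding basic_nbhd_def by force

lemma istopology_seminorm:
  "istopology (\<lambda>U. \<forall>f\<in>U. \<exists>R \<epsilon>. finite R \<and> R \<subseteq> F \<and> \<epsilon> > 0 \<and> basic_nbhd R \<epsilon> f \<subseteq> U)"
    (is "istopology (\<lambda>U. \<forall>f\<in>U. ?P f U)")
proof -
  have Int: "?P f (S \<inter> T)" if "?P f S" "?P f T" for f S T
  proof -
    from that(1) obtain R1 e1
      where 1: "finite R1" "R1 \<subseteq> F" "e1 > 0" "basic_nbhd R1 e1 f \<subseteq> S" by (elim exE conjE)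
    from that(2) obtain R2 e2
      where 2: "finite R2" "R2 \<subseteq> F" "e2 > 0" "basic_nbhd R2 e2 f \<subseteq> T" by (elim exE conjE)
    have "basic_nbhd (R1 \<union> R2) (min e1 e2) f \<subseteq> S"
      by (rule order_trans[OF basic_nbhd_mono 1(4)]) simp_all
    moreover have "basic_nbhd (R1 \<union> R2) (min e1 e2) f \<subseteq> T"
      by (rule order_trans[OF basic_nbhd_mono 2(4)]) simp_all
    ultimately show ?thesis
      using 1(1-3) 2(1-3)
      by (intro exI[of _ "R1 \<union> R2"] exI[of _ "min e1 e2"] conjI) simp_all
  qed
  have mono: "?P f T" if P: "?P f S" and ST: "S \<subseteq> T" for f S T
  proof -
    from P obtain R e
      where "finite R" "R \<subseteq> F" "e > 0" "basic_nbhd R e f \<subseteq> S" by (elim exE conjE)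
    then show ?thesis
      using order_trans[OF _ ST] by (intro exI[of _ R] exI[of _ e] conjI)
  qed
  show ?thesis
    unfolding istopology_def
  proof (intro conjI allI impI)
    fix S T assume S: "\<forall>f\<in>S. ?P f S" and T: "\<forall>f\<in>T. ?P f T"
    show "\<forall>f\<in>S \<inter> T. ?P f (S \<inter> T)"
      by (rule ballI, rule Int[OF bspec[OF S] bspec[OF T]]) (erule IntD1, erule IntD2)
  next
    fix \<U> assume U: "\<forall>U\<in>\<U>. \<forall>f\<in>U. ?P f U"
    show "\<forall>f\<in>\<Union>\<U>. ?P f (\<Union>\<U>)"
    proof (rule ballI, erule UnionE)
      fix f U assume "f \<in> U" "U \<in> \<U>"
      then show "?P f (\<Union>\<U>)"
        by (intro mono[OF bspec[OF bspec[OF U]] Union_upper])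
    qed
  qed
qed

lemma openin_seminorm_topology:
  "openin (seminorm_topology F) U \<longleftrightarrow>
    (\<forall>f\<in>U. \<exists>R \<epsilon>. finite R \<and> R \<subseteq> F \<and> \<epsilon> > 0 \<and> basic_nbhd R \<epsilon> f \<subseteq> U)"
  unfolding seminorm_topology_def
  by (rule fun_cong[OF topology_inverse'[OF istopology_seminorm]])

lemma topspace_seminorm_topology [simp]: "topspace (seminorm_topology F) = UNIV"
proof -
  have "openin (seminorm_topology F) UNIV"
    unfolding openin_seminorm_topology by (auto intro!: exI[of _ "{}"] exI[of _ "1::real"])
  then show ?thesis using openin_subset by auto
qed

definition vector_topology :: "'a::real_vector topology \<Rightarrow> bool" where
  "vector_topology T \<longleftrightarrow> topspace T = UNIV \<and>
     continuous_map (prod_topology T T) T (\<lambda>(x, y). x + y) \<and>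
     continuous_map (prod_topology euclideanreal T) T (\<lambda>(c, x). c *\<^sub>R x)"

definition locally_convex_topology :: "'a::real_vector topology \<Rightarrow> bool" where
  "locally_convex_topology T \<longleftrightarrow> vector_topology T \<and> neighbourhood_base_at 0 convex T"

definition locally_mult_convex_topology :: "'a::real_algebra topology \<Rightarrow> bool" where
  "locally_mult_convex_topology T \<longleftrightarrow> locally_convex_topology T \<and>
     neighbourhood_base_at 0 (\<lambda>U. \<forall>x\<in>U. \<forall>y\<in>U. x * y \<in> U) T"

section \<open>Evaluation seminorms, the supremum norm, and cones of polynomials\<close>

definition eval_seminorm :: "real ^ 'n::finite \<Rightarrow> 'n rpoly \<Rightarrow> real" where
  "eval_seminorm x f = \<bar>eval_poly f x\<bar>"

definition eval_seminorms :: "(real ^ 'n::finite) set \<Rightarrow> ('n rpoly \<Rightarrow> real) set" where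
  "eval_seminorms K = eval_seminorm ` K"

definition eval_topology :: "(real ^ 'n::finite) set \<Rightarrow> 'n rpoly topology" where
  "eval_topology K = seminorm_topology (eval_seminorms K)"

text \<open>The supremum is meaningful only if \<open>f\<close> is bounded on \<open>K\<close>, for example for compact nonempty \<open>K\<close>.\<close>

definition sup_norm :: "(real ^ 'n::finite) set \<Rightarrow> 'n rpoly \<Rightarrow> real" where
  "sup_norm K f = (SUP x\<in>K. \<bar>eval_poly f x\<bar>)"

definition sums_of_powers :: "nat \<Rightarrow> 'a::comm_semiring_1 set" where
  "sums_of_powers k = {\<Sum>i<m. g i ^ k | (m::nat) g. True}"

definition psd :: "(real ^ 'n::finite) set \<Rightarrow> 'n rpoly set" where
  "psd K = {f. \<forall>x\<in>K. 0 \<le> eval_poly f x}"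

end

theory Submission
  imports Defs
begin

text \<open>
  A polynomial vanishing on a Zariski dense set vanishes everywhere, hence is zero by Dedekind's
  independence of characters, since monomials are multiplicative; this makes the seminorms separate
  points. For the closures, a polynomial \<open>f\<close> that is nonnegative on a compact set \<open>S\<close> has a
  continuous root of order \<open>2 * d\<close> there; approximating the root uniformly on \<open>S\<close> by a polynomial \<open>g\<close>
  shows that already the single power \<open>g ^ (2 * d)\<close> is close to \<open>f\<close>. For the evaluation topology \<open>S\<close> is
  a finite subset of \<open>K\<close>, for the supremum norm it is \<open>K\<close>.
\<close>

section \<open>Polynomial functions\<close>

lemma eval_poly_diff: "eval_poly (p - q) x = eval_poly p x - eval_poly q x"
  using eval_poly_add[of "p - q" q x] by simp

lemma eval_poly_power: "eval_poly (p ^ k) x = eval_poly p x ^ k"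
  by (induction k) (simp_all add: eval_poly_mult)

lemma eval_poly_const: "eval_poly (Poly_Mapping.single 0 c) x = c"
  by (simp add: eval_poly_single)

lemma eval_poly_var: "eval_poly (Poly_Mapping.single (Poly_Mapping.single i 1) 1) x = x $ i"
proof -
  have "eval_monom (Poly_Mapping.single i 1) x = (\<Prod>j\<in>UNIV. if j = i then x $ i else 1)"
    unfolding eval_monom_def by (rule prod.cong) (auto simp: lookup_single when_def)
  then show ?thesis by (simp add: eval_poly_single)
qed

lemma continuous_on_eval_poly: "continuous_on S (eval_poly p)"
  unfolding eval_poly_def eval_monom_def by (intro continuous_intros)

section \<open>Linear independence of the monomial functions\<close>

lemma eval_monom_mult: "eval_monom m (\<chi> i. x $ i * y $ i) = eval_monom m x * eval_monom m y"
  by (simp add: eval_monom_def power_mult_distrib prod.distrib)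

text \<open>The separating point has 2 in a coordinate \<open>i\<close> where the exponents differ
  and 1 elsewhere. There a monomial takes the value 2 to the power of its \<open>i\<close>-th
  exponent, and powers of 2 determine their exponents.\<close>

lemma eval_monom_separates:
  assumes "m \<noteq> k"
  shows "\<exists>y. eval_monom m y \<noteq> eval_monom k y"
proof -
  obtain i where i: "Poly_Mapping.lookup m i \<noteq> Poly_Mapping.lookup k i"
    using assms by (metis poly_mapping_eqI)
  have "eval_monom l (\<chi> j. if j = i then 2 else 1) = 2 ^ Poly_Mapping.lookup l i" for l
  proof -
    have "eval_monom l (\<chi> j. if j = i then 2 else 1) =
        (\<Prod>j\<in>UNIV. if j = i then 2 ^ Poly_Mapping.lookup l i else 1)"
      unfolding eval_monom_def by (rule prod.cong) auto
    then show ?thesis by simp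
  qed
  then have "eval_monom m (\<chi> j. if j = i then 2 else 1) \<noteq> eval_monom k (\<chi> j. if j = i then 2 else 1)"
    using i by simp
  then show ?thesis by blast
qed

text \<open>Dedekind's argument: monomials are characters of the space under coordinatewise
  multiplication. Translating a relation by \<open>y\<close> and subtracting a multiple of the
  original one removes the term of \<open>a\<close>, which permits induction on the number of
  monomials.\<close>

lemma eval_monom_independent:
  assumes "finite A" "\<And>x. (\<Sum>m\<in>A. c m * eval_monom m x) = 0" "m \<in> A"
  shows "c m = 0"
  using assms
proof (induction A arbitrary: c m rule: finite_induct)
  case (insert a A)
  have *: "c k = 0" if "k \<in> A" for k
  proof -
    have "k \<noteq> a" using that insert.hyps by blast
    then obtain y where y: "eval_monom k y \<noteq> eval_monom a y" using eval_monom_separates by blast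
    \<comment> \<open>This is the relation at the coordinatewise product of \<open>x\<close> and
      \<open>y\<close> minus \<open>eval_monom a y\<close> times the relation at \<open>x\<close>.
      The coefficient of \<open>a\<close> becomes zero, so the sum over \<open>insert a A\<close>
      reduces to one over \<open>A\<close>.\<close>
    have "(\<Sum>m\<in>A. c m * (eval_monom m y - eval_monom a y) * eval_monom m x) = 0" for x
    proof -
      have "(\<Sum>m\<in>insert a A. c m * (eval_monom m y - eval_monom a y) * eval_monom m x) =
          (\<Sum>m\<in>insert a A. c m * eval_monom m (\<chi> i. x $ i * y $ i)) -
          eval_monom a y * (\<Sum>m\<in>insert a A. c m * eval_monom m x)"
        unfolding sum_distrib_left sum_subtractf[symmetric] eval_monom_mult
        by (rule sum.cong) (simp_all add: algebra_simps)
      also have "\<dots> = 0" by (simp only: insert.prems(1))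
      finally show ?thesis using insert.hyps by simp
    qed
    \<comment> \<open>The new coefficient of \<open>k\<close> vanishes; its second factor is nonzero
      by the choice of \<open>y\<close>, so \<open>c k\<close> is zero.\<close>
    from insert.IH[OF this that] y show ?thesis by simp
  qed
  \<comment> \<open>With all other coefficients zero, the relation at a single point where
    \<open>eval_monom a\<close> does not vanish settles \<open>c a\<close>.\<close>
  have "eval_monom a (\<chi> i. 1) = 1" by (simp add: eval_monom_def)
  with insert.prems(1)[of "\<chi> i. 1"] insert.hyps * have "c a = 0" by simp
  with * insert.prems(2) show ?case by blast
qed simp

lemma eval_poly_eq_0_imp:
  assumes "\<And>x. eval_poly p x = 0"
  shows "p = 0"
proof (rule poly_mapping_eqI)
  fix k
  have "Poly_Mapping.lookup p m = 0" if "m \<in> Poly_Mapping.keys p" for m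
    using eval_monom_independent[of "Poly_Mapping.keys p" "Poly_Mapping.lookup p" m] assms that
    by (simp add: eval_poly_def)
  then show "Poly_Mapping.lookup p k = Poly_Mapping.lookup 0 k"
    by (cases "k \<in> Poly_Mapping.keys p") (auto simp: in_keys_iff)
qed

text \<open>The zero locus of \<open>p\<close> is Zariski closed and contains \<open>K\<close>,
  hence contains the closure of \<open>K\<close>, which is the whole space.\<close>

lemma zariski_dense_eq_0:
  assumes "zariski_dense K" "\<And>x. x \<in> K \<Longrightarrow> eval_poly p x = 0"
  shows "p = 0"
proof -
  have "closedin zariski_topology (zero_locus {p})"
    unfolding closedin_zariski_topology by blast
  moreover have "K \<subseteq> zero_locus {p}" using assms(2) by (auto simp: zero_locus_def)
  ultimately have "zariski_topology closure_of K \<subseteq> zero_locus {p}" by (intro closure_of_minimal)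
  then have "eval_poly p x = 0" for x
    using assms(1) by (auto simp: zariski_dense_def zero_locus_def)
  then show ?thesis by (rule eval_poly_eq_0_imp)
qed

text \<open>This ensures that the supremum in \<open>sup_norm K\<close> is taken over a nonempty
  set.\<close>

lemma zariski_dense_nonempty: "zariski_dense K \<Longrightarrow> K \<noteq> {}"
  by (auto simp: zariski_dense_def)

section \<open>Uniform approximation by polynomials and by their even powers\<close>

lemma eval_poly_approximation:
  fixes h :: "real ^ 'n::finite \<Rightarrow> real"
  assumes "compact S" "continuous_on S h" "e > 0"
  shows "\<exists>g. \<forall>x\<in>S. \<bar>h x - eval_poly g x\<bar> < e"
proof -
  \<comment> \<open>Polynomial functions are continuous, form a ring containing the constants, and
    separate points through the coordinates, so Stone-Weierstrass applies on the compact set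
    \<open>S\<close>.\<close>
  interpret R: function_ring_on "range (eval_poly :: 'n rpoly \<Rightarrow> _)" S
  proof
    fix f assume "f \<in> range (eval_poly :: 'n rpoly \<Rightarrow> _)"
    then show "continuous_on S f" by (auto simp: continuous_on_eval_poly)
  next
    fix f g assume "f \<in> range (eval_poly :: 'n rpoly \<Rightarrow> _)" "g \<in> range (eval_poly :: 'n rpoly \<Rightarrow> _)"
    then obtain p q where pq: "f = eval_poly p" "g = eval_poly q" by blast
    show "(\<lambda>x. f x + g x) \<in> range eval_poly" "(\<lambda>x. f x * g x) \<in> range eval_poly"
      unfolding pq eval_poly_add[symmetric] eval_poly_mult[symmetric] by blast+
  next
    fix c :: real
    have "(\<lambda>_. c) = eval_poly (Poly_Mapping.single 0 c)" by (auto simp: eval_poly_const)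
    then show "(\<lambda>_. c) \<in> range eval_poly" by (rule range_eqI)
  next
    fix x y :: "real ^ 'n" assume "x \<noteq> y"
    then obtain i where "x $ i \<noteq> y $ i" by (auto simp: vec_eq_iff)
    then show "\<exists>f\<in>range (eval_poly :: 'n rpoly \<Rightarrow> _). f x \<noteq> f y"
      by (intro bexI[of _ "eval_poly (Poly_Mapping.single (Poly_Mapping.single i 1) 1)"])
        (simp_all only: eval_poly_var rangeI not_False_eq_True)
  qed (rule assms(1))
  from R.Stone_Weierstrass_basic[OF assms(2,3)] show ?thesis by blast
qed

lemma psd_approximation:
  fixes f :: "'n::finite rpoly"
  assumes S: "compact S" "f \<in> psd S" and "d \<ge> 1" "e > 0"
  shows "\<exists>g. \<forall>x\<in>S. \<bar>eval_poly (f - g ^ (2 * d)) x\<bar> \<le> e"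
proof -
  \<comment> \<open>\<open>root\<close> is extended to negative arguments as an odd function, so
    \<open>h\<close> is continuous as a composition; the nonnegativity of \<open>f\<close> on
    \<open>S\<close> enters in \<open>h_pow\<close>.\<close>
  define h where "h x = root (2 * d) (eval_poly f x)" for x
  have d: "2 * d > 0" using \<open>d \<ge> 1\<close> by simp
  have h_cont: "continuous_on S h"
    unfolding h_def by (intro continuous_intros continuous_on_eval_poly)
  have h_pow: "h x ^ (2 * d) = eval_poly f x" if "x \<in> S" for x
    unfolding h_def using S(2) that d by (intro real_root_pow_pos2) (auto simp: psd_def)
  have "bounded (h ` S)" by (intro compact_imp_bounded compact_continuous_image h_cont S(1))
  then obtain M where M: "\<And>x. x \<in> S \<Longrightarrow> \<bar>h x\<bar> \<le> M" by (auto simp: bounded_iff)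
  \<comment> \<open>The values of \<open>h\<close> lie between -M and M. The margin of 1 on both
    sides also catches the values of an approximation \<open>g\<close> with error below 1, which
    explains the bound \<open>min \<delta> 1\<close> below.\<close>
  have "uniformly_continuous_on {- M - 1..M + 1} (\<lambda>t::real. t ^ (2 * d))"
    by (intro compact_uniformly_continuous continuous_intros) simp
  then obtain \<delta> where \<delta>: "\<delta> > 0" "\<And>s t. s \<in> {- M - 1..M + 1} \<Longrightarrow> t \<in> {- M - 1..M + 1} \<Longrightarrow>
      \<bar>s - t\<bar> < \<delta> \<Longrightarrow> \<bar>s ^ (2 * d) - t ^ (2 * d)\<bar> < e"
    using \<open>e > 0\<close> unfolding uniformly_continuous_on_def dist_real_def by metis
  obtain g where g: "\<And>x. x \<in> S \<Longrightarrow> \<bar>h x - eval_poly g x\<bar> < min \<delta> 1"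
    using eval_poly_approximation[OF S(1) h_cont, of "min \<delta> 1"] \<delta>(1) by auto
  have "\<bar>eval_poly (f - g ^ (2 * d)) x\<bar> \<le> e" if x: "x \<in> S" for x
  proof -
    have "\<bar>h x ^ (2 * d) - eval_poly g x ^ (2 * d)\<bar> < e"
      using M[OF x] g[OF x] by (intro \<delta>(2)) auto
    then show ?thesis by (simp add: eval_poly_diff eval_poly_power h_pow[OF x])
  qed
  then show ?thesis by blast
qed

lemma power_in_sums_of_powers: "g ^ k \<in> sums_of_powers k"
  unfolding sums_of_powers_def by (auto intro!: exI[of _ "1::nat"] exI[of _ "\<lambda>_. g"])

lemma sums_of_powers_nonneg: "s \<in> sums_of_powers (2 * d) \<Longrightarrow> 0 \<le> eval_poly s x"
  by (auto simp: sums_of_powers_def eval_poly_sum eval_poly_power intro!: sum_nonneg)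

section \<open>Seminorm topologies\<close>

lemma seminorm_nonneg: "seminorm \<rho> \<Longrightarrow> 0 \<le> \<rho> x"
  and seminorm_triangle: "seminorm \<rho> \<Longrightarrow> \<rho> (x + y) \<le> \<rho> x + \<rho> y"
  and seminorm_scaleR: "seminorm \<rho> \<Longrightarrow> \<rho> (c *\<^sub>R x) = \<bar>c\<bar> * \<rho> x"
  by (auto simp: seminorm_def)

lemma seminorm_0: "seminorm \<rho> \<Longrightarrow> \<rho> 0 = 0"
  using seminorm_scaleR[of \<rho> 0 0] by simp

lemma seminorm_minus: "seminorm \<rho> \<Longrightarrow> \<rho> (- x) = \<rho> x"
  using seminorm_scaleR[of \<rho> "-1" x] by simp

text \<open>The strict counterpart of \<open>basic_nbhd\<close>. Strict inequalities leave room
  around every member, so for finitely many generating seminorms these sets are open, and they serve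
  as witnesses wherever an open set is required.\<close>

definition open_nbhd :: "('a::real_vector \<Rightarrow> real) set \<Rightarrow> real \<Rightarrow> 'a \<Rightarrow> 'a set" where
  "open_nbhd R \<epsilon> f = {g. \<forall>\<rho>\<in>R. \<rho> (f - g) < \<epsilon>}"

lemma open_nbhd_subset_basic_nbhd: "open_nbhd R \<epsilon> f \<subseteq> basic_nbhd R \<epsilon> f"
  by (force simp: open_nbhd_def basic_nbhd_def)

lemma center_in_open_nbhd: "\<forall>\<rho>\<in>R. seminorm \<rho> \<Longrightarrow> \<epsilon> > 0 \<Longrightarrow> f \<in> open_nbhd R \<epsilon> f"
  by (simp add: open_nbhd_def seminorm_0)

lemma openin_open_nbhd:
  assumes F: "\<forall>\<rho>\<in>F. seminorm \<rho>" and R: "finite R" "R \<subseteq> F"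
  shows "openin (seminorm_topology F) (open_nbhd R \<epsilon> f)"
  unfolding openin_seminorm_topology
proof
  fix g assume g: "g \<in> open_nbhd R \<epsilon> f"
  \<comment> \<open>Half of the smallest slack that \<open>g\<close> leaves in the constraints.
    Halving turns the nonstrict bound of \<open>basic_nbhd\<close> into a strict one after the
    triangle inequality; the inserted 1 keeps \<open>Min\<close> meaningful for empty
    \<open>R\<close>.\<close>
  define \<delta> where "\<delta> = Min (insert 1 ((\<lambda>\<rho>. (\<epsilon> - \<rho> (f - g)) / 2) ` R))"
  have \<delta>_pos: "\<delta> > 0"
    using g R(1) by (auto simp: \<delta>_def open_nbhd_def)
  have "\<rho> (f - h) < \<epsilon>" if "\<rho> \<in> R" "h \<in> basic_nbhd R \<delta> g" for \<rho> h
  proof -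
    have "\<delta> \<le> (\<epsilon> - \<rho> (f - g)) / 2"
      unfolding \<delta>_def using R(1) that(1) by (intro Min_le) auto
    moreover have "\<rho> (g - h) \<le> \<delta>" using that by (simp add: basic_nbhd_def)
    moreover have "\<rho> (f - h) \<le> \<rho> (f - g) + \<rho> (g - h)"
      using seminorm_triangle[of \<rho> "f - g" "g - h"] F R(2) that(1) by auto
    moreover have "\<rho> (f - g) < \<epsilon>" using g that(1) by (simp add: open_nbhd_def)
    ultimately show ?thesis by argo
  qed
  then have "basic_nbhd R \<delta> g \<subseteq> open_nbhd R \<epsilon> f" by (auto simp: open_nbhd_def)
  with R \<delta>_pos
  show "\<exists>R' \<delta>. finite R' \<and> R' \<subseteq> F \<and> \<delta> > 0 \<and> basic_nbhd R' \<delta> g \<subseteq> open_nbhd R \<epsilon> f" by blast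
qed

text \<open>Turns both closure computations into approximation problems. One direction tests the
  closure against the open set \<open>open_nbhd R \<epsilon> f\<close>; the other uses that every
  open set around \<open>f\<close> contains a basic neighbourhood.\<close>

lemma in_closure_of_seminorm_topology:
  assumes F: "\<forall>\<rho>\<in>F. seminorm \<rho>"
  shows "f \<in> seminorm_topology F closure_of S \<longleftrightarrow>
    (\<forall>R \<epsilon>. finite R \<longrightarrow> R \<subseteq> F \<longrightarrow> \<epsilon> > 0 \<longrightarrow> (\<exists>g\<in>S. g \<in> basic_nbhd R \<epsilon> f))"
proof
  assume f: "f \<in> seminorm_topology F closure_of S"
  show "\<forall>R \<epsilon>. finite R \<longrightarrow> R \<subseteq> F \<longrightarrow> \<epsilon> > 0 \<longrightarrow> (\<exists>g\<in>S. g \<in> basic_nbhd R \<epsilon> f)"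
  proof (intro allI impI)
    fix R and \<epsilon> :: real
    assume R: "finite R" "R \<subseteq> F" and "\<epsilon> > 0"
    then have "f \<in> open_nbhd R \<epsilon> f" using F by (intro center_in_open_nbhd) auto
    with f openin_open_nbhd[OF F R] obtain g where "g \<in> S" "g \<in> open_nbhd R \<epsilon> f"
      unfolding in_closure_of by blast
    then show "\<exists>g\<in>S. g \<in> basic_nbhd R \<epsilon> f" using open_nbhd_subset_basic_nbhd by blast
  qed
next
  assume *: "\<forall>R \<epsilon>. finite R \<longrightarrow> R \<subseteq> F \<longrightarrow> \<epsilon> > 0 \<longrightarrow> (\<exists>g\<in>S. g \<in> basic_nbhd R \<epsilon> f)"
  have "\<exists>g\<in>S. g \<in> U" if U: "openin (seminorm_topology F) U" "f \<in> U" for U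
  proof -
    from U obtain R \<epsilon> where "finite R" "R \<subseteq> F" "\<epsilon> > 0" "basic_nbhd R \<epsilon> f \<subseteq> U"
      unfolding openin_seminorm_topology by meson
    with * show ?thesis by blast
  qed
  then show "f \<in> seminorm_topology F closure_of S" by (auto simp: in_closure_of)
qed

section \<open>Continuity of the vector operations, local convexity and separation\<close>

lemma continuous_map_seminorm_add:
  assumes F: "\<forall>\<rho>\<in>F. seminorm \<rho>"
  shows "continuous_map (prod_topology (seminorm_topology F) (seminorm_topology F))
    (seminorm_topology F) (\<lambda>(x, y). x + y)"
proof -
  let ?T = "seminorm_topology F"
  have "\<exists>V W. openin ?T V \<and> openin ?T W \<and> x \<in> V \<and> y \<in> W \<and> V \<times> W \<subseteq> {(x, y). x + y \<in> U}"
    if U: "openin ?T U" "x + y \<in> U" for U x y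
  proof -
    from U obtain R \<epsilon> where R: "finite R" "R \<subseteq> F" "\<epsilon> > 0" "basic_nbhd R \<epsilon> (x + y) \<subseteq> U"
      unfolding openin_seminorm_topology by meson
    have "x' + y' \<in> basic_nbhd R \<epsilon> (x + y)"
      if "x' \<in> open_nbhd R (\<epsilon>/2) x" "y' \<in> open_nbhd R (\<epsilon>/2) y" for x' y'
      unfolding basic_nbhd_def
    proof (intro CollectI ballI)
      fix \<rho> assume \<rho>: "\<rho> \<in> R"
      then have "\<rho> ((x - x') + (y - y')) \<le> \<rho> (x - x') + \<rho> (y - y')"
        using F R(2) by (intro seminorm_triangle) auto
      moreover have "\<rho> (x - x') < \<epsilon>/2" "\<rho> (y - y') < \<epsilon>/2"
        using that \<rho> by (auto simp: open_nbhd_def)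
      ultimately show "\<rho> (x + y - (x' + y')) \<le> \<epsilon>" by (simp add: algebra_simps)
    qed
    moreover have "x \<in> open_nbhd R (\<epsilon>/2) x" "y \<in> open_nbhd R (\<epsilon>/2) y"
      using R F by (auto intro!: center_in_open_nbhd)
    ultimately show ?thesis
      using R openin_open_nbhd[OF F R(1,2)]
      by (intro exI[of _ "open_nbhd R (\<epsilon>/2) x"] exI[of _ "open_nbhd R (\<epsilon>/2) y"]) auto
  qed
  then show ?thesis
    unfolding continuous_map_def
    by (auto simp: openin_prod_topology_alt case_prod_unfold)
qed

lemma continuous_map_seminorm_scaleR:
  assumes F: "\<forall>\<rho>\<in>F. seminorm \<rho>"
  shows "continuous_map (prod_topology euclideanreal (seminorm_topology F))
    (seminorm_topology F) (\<lambda>(c, x). c *\<^sub>R x)"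
proof -
  let ?T = "seminorm_topology F"
  have "\<exists>V W. open V \<and> openin ?T W \<and> c \<in> V \<and> x \<in> W \<and> V \<times> W \<subseteq> {(c, x). c *\<^sub>R x \<in> U}"
    if U: "openin ?T U" "c *\<^sub>R x \<in> U" for U c x
  proof -
    from U obtain R \<epsilon> where R: "finite R" "R \<subseteq> F" "\<epsilon> > 0" "basic_nbhd R \<epsilon> (c *\<^sub>R x) \<subseteq> U"
      unfolding openin_seminorm_topology by meson
    \<comment> \<open>Since seminorms are nonnegative, the finite sum is a common bound for all
      \<open>\<rho> x\<close> with \<open>\<rho>\<close> in \<open>R\<close>.\<close>
    define M where "M = (\<Sum>\<rho>\<in>R. \<rho> x)"
    have sn: "seminorm \<rho>" if "\<rho> \<in> R" for \<rho> using that F R(2) by auto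
    have M: "\<rho> x \<le> M" if "\<rho> \<in> R" for \<rho>
      unfolding M_def using that R(1) by (intro member_le_sum) (auto intro: seminorm_nonneg sn)
    have M0: "0 \<le> M" unfolding M_def by (intro sum_nonneg seminorm_nonneg sn)
    \<comment> \<open>The error splits as
      \<open>(c - c') *\<^sub>R x + c' *\<^sub>R (x - x')\<close>, and each part is to be at most
      half of \<open>\<epsilon>\<close>. The cap 1 gives the bound \<open>\<bar>c\<bar> + 1\<close>
      on the modulus of \<open>c'\<close>; adding 1 to \<open>M\<close> and to
      \<open>\<bar>c\<bar>\<close> keeps the denominators positive.\<close>
    define \<delta> where "\<delta> = min 1 (\<epsilon> / (2 * (M + 1)))"
    define \<eta> where "\<eta> = \<epsilon> / (2 * (\<bar>c\<bar> + 1))"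
    have pos: "\<delta> > 0" "\<eta> > 0" using R(3) M0 by (auto simp: \<delta>_def \<eta>_def)
    have "c' *\<^sub>R x' \<in> basic_nbhd R \<epsilon> (c *\<^sub>R x)"
      if c': "c' \<in> ball c \<delta>" and x': "x' \<in> open_nbhd R \<eta> x" for c' x'
      unfolding basic_nbhd_def
    proof (intro CollectI ballI)
      fix \<rho> assume \<rho>: "\<rho> \<in> R"
      have c: "\<bar>c - c'\<bar> \<le> \<epsilon> / (2 * (M + 1))" "\<bar>c'\<bar> \<le> \<bar>c\<bar> + 1"
        using c' by (auto simp: \<delta>_def dist_real_def)
      have x: "\<rho> (x - x') \<le> \<eta>" using x' \<rho> by (force simp: open_nbhd_def)
      have "c *\<^sub>R x - c' *\<^sub>R x' = (c - c') *\<^sub>R x + c' *\<^sub>R (x - x')" by (simp add: algebra_simps)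
      then have "\<rho> (c *\<^sub>R x - c' *\<^sub>R x') \<le> \<bar>c - c'\<bar> * \<rho> x + \<bar>c'\<bar> * \<rho> (x - x')"
        using seminorm_triangle[OF sn[OF \<rho>], of "(c - c') *\<^sub>R x" "c' *\<^sub>R (x - x')"]
        by (simp add: seminorm_scaleR[OF sn[OF \<rho>]])
      also have "\<bar>c - c'\<bar> * \<rho> x \<le> \<epsilon> / (2 * (M + 1)) * (M + 1)"
        using M[OF \<rho>] c R(3) M0 by (intro mult_mono seminorm_nonneg[OF sn[OF \<rho>]]) auto
      also have "\<dots> = \<epsilon> / 2" using M0 by (simp add: field_simps)
      also have "\<bar>c'\<bar> * \<rho> (x - x') \<le> (\<bar>c\<bar> + 1) * \<eta>"
        using x c by (intro mult_mono seminorm_nonneg[OF sn[OF \<rho>]]) auto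
      also have "\<dots> = \<epsilon> / 2" by (simp add: \<eta>_def field_simps)
      finally show "\<rho> (c *\<^sub>R x - c' *\<^sub>R x') \<le> \<epsilon>" by simp
    qed
    moreover have "x \<in> open_nbhd R \<eta> x" using sn pos by (auto intro!: center_in_open_nbhd)
    ultimately show ?thesis
      using R pos openin_open_nbhd[OF F R(1,2)]
      by (intro exI[of _ "ball c \<delta>"] exI[of _ "open_nbhd R \<eta> x"]) auto
  qed
  then show ?thesis
    unfolding continuous_map_def
    by (auto simp: openin_prod_topology_alt case_prod_unfold)
qed

lemma open_nbhd_convex:
  assumes "\<forall>\<rho>\<in>R. seminorm \<rho>"
  shows "convex (open_nbhd R \<epsilon> f)"
proof (rule convexI)
  fix x y and u v :: real
  assume xy: "x \<in> open_nbhd R \<epsilon> f" "y \<in> open_nbhd R \<epsilon> f" and uv: "0 \<le> u" "0 \<le> v" "u + v = 1"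
  show "u *\<^sub>R x + v *\<^sub>R y \<in> open_nbhd R \<epsilon> f"
    unfolding open_nbhd_def
  proof (intro CollectI ballI)
    fix \<rho> assume \<rho>: "\<rho> \<in> R"
    with assms have sn: "seminorm \<rho>" by blast
    have "f - (u *\<^sub>R x + v *\<^sub>R y) = u *\<^sub>R (f - x) + v *\<^sub>R (f - y)"
      using uv(3) scaleR_left_distrib[of u v f] by (simp add: algebra_simps)
    then have "\<rho> (f - (u *\<^sub>R x + v *\<^sub>R y)) \<le> u * \<rho> (f - x) + v * \<rho> (f - y)"
      using seminorm_triangle[OF sn, of "u *\<^sub>R (f - x)" "v *\<^sub>R (f - y)"] uv
      by (simp add: seminorm_scaleR[OF sn])
    also have "\<dots> < \<epsilon>"
      using xy \<rho> uv by (intro convex_bound_lt) (auto simp: open_nbhd_def)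
    finally show "\<rho> (f - (u *\<^sub>R x + v *\<^sub>R y)) < \<epsilon>" .
  qed
qed

lemma locally_mult_convex_seminorm_topology:
  assumes F: "\<forall>\<rho>\<in>F. multiplicative_seminorm \<rho>"
  shows "locally_mult_convex_topology (seminorm_topology F)"
proof -
  have sn: "\<forall>\<rho>\<in>F. seminorm \<rho>" using F by (simp add: multiplicative_seminorm_def)
  have "\<exists>V. openin (seminorm_topology F) V \<and> 0 \<in> V \<and> V \<subseteq> W \<and> convex V \<and> (\<forall>x\<in>V. \<forall>y\<in>V. x * y \<in> V)"
    if W: "openin (seminorm_topology F) W" "0 \<in> W" for W
  proof -
    from W obtain R \<epsilon> where R: "finite R" "R \<subseteq> F" "\<epsilon> > 0" "basic_nbhd R \<epsilon> 0 \<subseteq> W"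
      unfolding openin_seminorm_topology by meson
    \<comment> \<open>A ball of radius at most 1 for submultiplicative seminorms is closed under
      products; radius at most \<open>\<epsilon>\<close> keeps it inside \<open>W\<close>.\<close>
    define V where "V = open_nbhd R (min 1 \<epsilon>) (0 :: 'a)"
    have snR: "\<forall>\<rho>\<in>R. seminorm \<rho>" using sn R(2) by blast
    have V_iff: "x \<in> V \<longleftrightarrow> (\<forall>\<rho>\<in>R. \<rho> x < min 1 \<epsilon>)" for x
      using snR by (simp add: V_def open_nbhd_def seminorm_minus)
    have "V \<subseteq> W"
      unfolding V_def
      using open_nbhd_subset_basic_nbhd basic_nbhd_mono[of R R "min 1 \<epsilon>" \<epsilon>] R(4) by fastforce
    moreover have "x * y \<in> V" if "x \<in> V" "y \<in> V" for x y
      unfolding V_iff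
    proof
      fix \<rho> assume \<rho>: "\<rho> \<in> R"
      then have "\<rho> (x * y) \<le> \<rho> x * \<rho> y"
        using F R(2) by (auto simp: multiplicative_seminorm_def)
      also have "\<dots> \<le> \<rho> x * 1"
        using that \<rho> snR by (intro mult_left_mono) (force simp: V_iff seminorm_nonneg)+
      also have "\<dots> < min 1 \<epsilon>" using that \<rho> unfolding V_iff by simp
      finally show "\<rho> (x * y) < min 1 \<epsilon>" .
    qed
    moreover have "openin (seminorm_topology F) V"
      unfolding V_def by (rule openin_open_nbhd[OF sn R(1,2)])
    moreover have "0 \<in> V" unfolding V_def using R(3) snR by (intro center_in_open_nbhd) auto
    moreover have "convex V" unfolding V_def by (rule open_nbhd_convex[OF snR])
    ultimately show ?thesis by blast
  qed
  \<comment> \<open>The same \<open>V\<close> is open, convex and closed under products, so it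
    serves as both the open set and the neighbourhood in each of the two neighbourhood
    bases.\<close>
  then show ?thesis
    using continuous_map_seminorm_add[OF sn] continuous_map_seminorm_scaleR[OF sn]
    unfolding locally_mult_convex_topology_def locally_convex_topology_def vector_topology_def
      neighbourhood_base_at_def
    by (auto 0 0) (meson subset_refl)+
qed

lemma Hausdorff_seminorm_topology:
  assumes F: "\<forall>\<rho>\<in>F. seminorm \<rho>" and sep: "\<And>f. f \<noteq> 0 \<Longrightarrow> \<exists>\<rho>\<in>F. \<rho> f \<noteq> 0"
  shows "Hausdorff_space (seminorm_topology F)"
  unfolding Hausdorff_space_def
proof (intro allI impI, elim conjE)
  fix f g :: 'a assume "f \<noteq> g"
  with sep[of "f - g"] obtain \<rho> where \<rho>: "\<rho> \<in> F" "\<rho> (f - g) \<noteq> 0" by auto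
  with F have sn: "seminorm \<rho>" by blast
  \<comment> \<open>A common point of the two balls of this radius would make
    \<open>\<rho> (f - g)\<close> smaller than itself.\<close>
  define \<epsilon> where "\<epsilon> = \<rho> (f - g) / 2"
  have \<epsilon>: "\<epsilon> > 0" using \<rho>(2) seminorm_nonneg[OF sn, of "f - g"] by (simp add: \<epsilon>_def)
  have "\<not> (\<rho> (f - h) < \<epsilon> \<and> \<rho> (g - h) < \<epsilon>)" for h
    using seminorm_triangle[OF sn, of "f - h" "h - g"] seminorm_minus[OF sn, of "g - h"]
    by (simp add: \<epsilon>_def)
  then have "disjnt (open_nbhd {\<rho>} \<epsilon> f) (open_nbhd {\<rho>} \<epsilon> g)"
    by (auto simp: disjnt_def open_nbhd_def)
  then show "\<exists>U V. openin (seminorm_topology F) U \<and> openin (seminorm_topology F) V \<and>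
      f \<in> U \<and> g \<in> V \<and> disjnt U V"
    using \<rho>(1) \<epsilon> sn openin_open_nbhd[OF F, of "{\<rho>}" \<epsilon>] center_in_open_nbhd[of "{\<rho>}" \<epsilon>]
    by (intro exI[of _ "open_nbhd {\<rho>} \<epsilon> f"] exI[of _ "open_nbhd {\<rho>} \<epsilon> g"]) simp
qed

section \<open>Evaluation seminorms and the supremum norm\<close>

lemma multiplicative_eval_seminorms: "\<rho> \<in> eval_seminorms K \<Longrightarrow> multiplicative_seminorm \<rho>"
  by (auto simp: eval_seminorms_def eval_seminorm_def multiplicative_seminorm_def seminorm_def
      eval_poly_add eval_poly_scaleR eval_poly_mult abs_mult)

text \<open>Compactness makes the values bounded above, which is what lets the real supremum
  dominate each of them.\<close>

lemma abs_eval_poly_le_sup_norm: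
  assumes "compact K" "x \<in> K"
  shows "\<bar>eval_poly f x\<bar> \<le> sup_norm K f"
  unfolding sup_norm_def
proof (rule cSUP_upper[OF assms(2)])
  have "compact ((\<lambda>x. \<bar>eval_poly f x\<bar>) ` K)"
    by (intro compact_continuous_image continuous_intros continuous_on_eval_poly assms(1))
  then show "bdd_above ((\<lambda>x. \<bar>eval_poly f x\<bar>) ` K)"
    by (intro bounded_imp_bdd_above compact_imp_bounded)
qed

lemma sup_norm_least:
  assumes "K \<noteq> {}" "\<And>x. x \<in> K \<Longrightarrow> \<bar>eval_poly f x\<bar> \<le> c"
  shows "sup_norm K f \<le> c"
  unfolding sup_norm_def using assms by (intro cSUP_least)

lemma seminorm_sup_norm:
  fixes K :: "(real ^ 'n::finite) set"
  assumes K: "compact K" "K \<noteq> {}"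
  shows "seminorm (sup_norm K)"
proof -
  note le = abs_eval_poly_le_sup_norm[OF K(1)]
  have nonneg: "0 \<le> sup_norm K f" for f
    using K(2) le[of _ f] by (meson abs_ge_zero ex_in_conv order_trans)
  have scale_le: "sup_norm K (c *\<^sub>R f) \<le> \<bar>c\<bar> * sup_norm K f" for c f
    by (rule sup_norm_least[OF K(2)]) (simp add: eval_poly_scaleR abs_mult mult_left_mono le)
  \<comment> \<open>For nonzero \<open>c\<close> the reverse inequality is \<open>scale_le\<close>
    applied to the inverse scalar and the scaled polynomial.\<close>
  have "\<bar>c\<bar> * sup_norm K f \<le> sup_norm K (c *\<^sub>R f)" for c f
  proof (cases "c = 0")
    case False
    then show ?thesis using scale_le[of "inverse c" "c *\<^sub>R f"] by (simp add: field_simps)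
  qed (simp add: nonneg)
  moreover have "sup_norm K (f + g) \<le> sup_norm K f + sup_norm K g" for f g
    by (rule sup_norm_least[OF K(2)], unfold eval_poly_add)
      (rule order_trans[OF abs_triangle_ineq add_mono[OF le le]])
  ultimately show ?thesis
    unfolding seminorm_def using nonneg scale_le by (auto intro: antisym)
qed

section \<open>Closures of the cone of sums of even powers\<close>

lemma eval_topology_closure_of_sums_of_powers:
  fixes K :: "(real ^ 'n::finite) set"
  assumes "d \<ge> 1"
  shows "eval_topology K closure_of sums_of_powers (2 * d) = psd K"
proof -
  have sn: "\<forall>\<rho>\<in>eval_seminorms K. seminorm \<rho>"
    using multiplicative_eval_seminorms by (auto simp: multiplicative_seminorm_def)
  show ?thesis
    unfolding eval_topology_def
  proof (intro set_eqI iffI)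
    fix f assume f: "f \<in> seminorm_topology (eval_seminorms K) closure_of sums_of_powers (2 * d)"
    \<comment> \<open>The single seminorm at \<open>x\<close> suffices: within every
      \<open>e\<close> of the value of \<open>f\<close> lies the nonnegative value of a sum of even
      powers.\<close>
    have "0 \<le> eval_poly f x" if x: "x \<in> K" for x
    proof (rule field_le_epsilon)
      fix e :: real assume "e > 0"
      then obtain g where g: "g \<in> sums_of_powers (2 * d)" "g \<in> basic_nbhd {eval_seminorm x} e f"
        using f x unfolding in_closure_of_seminorm_topology[OF sn]
        by (auto simp: eval_seminorms_def dest!: spec[of _ "{eval_seminorm x}"])
      then show "0 \<le> eval_poly f x + e"
        using sums_of_powers_nonneg[OF g(1), of x]
        by (simp add: basic_nbhd_def eval_seminorm_def eval_poly_diff)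
    qed
    then show "f \<in> psd K" by (simp add: psd_def)
  next
    fix f assume f: "f \<in> psd K"
    show "f \<in> seminorm_topology (eval_seminorms K) closure_of sums_of_powers (2 * d)"
      unfolding in_closure_of_seminorm_topology[OF sn]
    proof (intro allI impI)
      fix R and e :: real
      assume "finite R" "R \<subseteq> eval_seminorms K" and e: "e > 0"
      \<comment> \<open>A finite subfamily of seminorms is the image of a finite, hence compact, set
        of points, on which \<open>psd_approximation\<close> applies.\<close>
      then obtain S where S: "finite S" "S \<subseteq> K" "R = eval_seminorm ` S"
        unfolding eval_seminorms_def by (meson finite_subset_image)
      have "f \<in> psd S" using f S(2) by (auto simp: psd_def)
      from psd_approximation[OF finite_imp_compact[OF S(1)] this assms e]
      obtain g where "\<forall>x\<in>S. \<bar>eval_poly (f - g ^ (2 * d)) x\<bar> \<le> e" by blast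
      then have "g ^ (2 * d) \<in> basic_nbhd R e f"
        by (simp add: basic_nbhd_def S(3) eval_seminorm_def)
      then show "\<exists>g\<in>sums_of_powers (2 * d). g \<in> basic_nbhd R e f"
        using power_in_sums_of_powers by blast
    qed
  qed
qed

lemma sup_norm_closure_of_sums_of_powers:
  fixes K :: "(real ^ 'n::finite) set"
  assumes K: "compact K" "K \<noteq> {}" and "d \<ge> 1"
  shows "seminorm_topology {sup_norm K} closure_of sums_of_powers (2 * d) = psd K"
proof -
  have sn: "\<forall>\<rho>\<in>{sup_norm K}. seminorm \<rho>" using seminorm_sup_norm[OF K] by simp
  show ?thesis
  proof (intro set_eqI iffI)
    fix f assume f: "f \<in> seminorm_topology {sup_norm K} closure_of sums_of_powers (2 * d)"
    have "0 \<le> eval_poly f x" if x: "x \<in> K" for x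
    proof (rule field_le_epsilon)
      fix e :: real assume "e > 0"
      then obtain g where g: "g \<in> sums_of_powers (2 * d)" "g \<in> basic_nbhd {sup_norm K} e f"
        using f unfolding in_closure_of_seminorm_topology[OF sn]
        by (auto dest!: spec[of _ "{sup_norm K}"])
      then show "0 \<le> eval_poly f x + e"
        using sums_of_powers_nonneg[OF g(1), of x] abs_eval_poly_le_sup_norm[OF K(1) x, of "f - g"]
        by (simp add: basic_nbhd_def eval_poly_diff)
    qed
    then show "f \<in> psd K" by (simp add: psd_def)
  next
    fix f assume f: "f \<in> psd K"
    show "f \<in> seminorm_topology {sup_norm K} closure_of sums_of_powers (2 * d)"
      unfolding in_closure_of_seminorm_topology[OF sn]
    proof (intro allI impI)
      fix R and e :: real
      assume R: "R \<subseteq> {sup_norm K}" and e: "e > 0"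
      from psd_approximation[OF K(1) f assms(3) e]
      obtain g where "\<forall>x\<in>K. \<bar>eval_poly (f - g ^ (2 * d)) x\<bar> \<le> e" by blast
      then have "sup_norm K (f - g ^ (2 * d)) \<le> e" using K(2) by (intro sup_norm_least) auto
      \<comment> \<open>\<open>R\<close> is empty or consists of \<open>sup_norm K\<close> alone;
        the one estimate covers both cases.\<close>
      then have "g ^ (2 * d) \<in> basic_nbhd R e f" using R by (auto simp: basic_nbhd_def)
      then show "\<exists>g\<in>sums_of_powers (2 * d). g \<in> basic_nbhd R e f"
        using power_in_sums_of_powers by blast
    qed
  qed
qed

theorem corollary6p1:
  fixes K :: "(real ^ 'n::finite) set" and d :: nat
  assumes "closed K" and "zariski_dense K" and "d \<ge> 1"
  shows "((\<forall>\<rho>\<in>eval_seminorms K. multiplicative_seminorm \<rho>) \<and>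
          locally_mult_convex_topology (eval_topology K) \<and>
          Hausdorff_space (eval_topology K) \<and>
          eval_topology K closure_of sums_of_powers (2 * d) = psd K) \<and>
         (compact K \<longrightarrow>
          is_norm (sup_norm K) \<and>
          seminorm_topology {sup_norm K} closure_of sums_of_powers (2 * d) = psd K)"
proof (intro conjI impI)
  show mult: "\<forall>\<rho>\<in>eval_seminorms K. multiplicative_seminorm \<rho>"
    using multiplicative_eval_seminorms by blast
  show "locally_mult_convex_topology (eval_topology K)"
    unfolding eval_topology_def by (rule locally_mult_convex_seminorm_topology[OF mult])
  show "Hausdorff_space (eval_topology K)"
    unfolding eval_topology_def
  proof (rule Hausdorff_seminorm_topology)
    show "\<forall>\<rho>\<in>eval_seminorms K. seminorm \<rho>" using mult by (simp add: multiplicative_seminorm_def)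
    \<comment> \<open>If all evaluation seminorms over \<open>K\<close> vanish at \<open>f\<close>,
      then \<open>f\<close> is zero on a Zariski dense set.\<close>
    show "\<exists>\<rho>\<in>eval_seminorms K. \<rho> f \<noteq> 0" if "f \<noteq> 0" for f
      using zariski_dense_eq_0[OF assms(2), of f] that
      by (auto simp: eval_seminorms_def eval_seminorm_def)
  qed
  show "eval_topology K closure_of sums_of_powers (2 * d) = psd K"
    by (rule eval_topology_closure_of_sums_of_powers[OF assms(3)])
  assume K: "compact K"
  note ne = zariski_dense_nonempty[OF assms(2)]
  show "seminorm_topology {sup_norm K} closure_of sums_of_powers (2 * d) = psd K"
    by (rule sup_norm_closure_of_sums_of_powers[OF K ne assms(3)])
  \<comment> \<open>Definiteness again comes from density: a zero supremum makes \<open>f\<close>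
    vanish on \<open>K\<close>.\<close>
  have "f = 0" if "sup_norm K f = 0" for f
    using abs_eval_poly_le_sup_norm[OF K, of _ f] that
    by (intro zariski_dense_eq_0[OF assms(2)]) simp
  then show "is_norm (sup_norm K)"
    unfolding is_norm_def using seminorm_sup_norm[OF K ne] by blast
qed

end
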